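(* Let $F$ be a graph and let $U, W \subseteq V(F)$ be disjoint vertex sets such that $|U \cup W| = r$, there is exactly one edge of $F$ with one endpoint in $U$ and the other in $W$, and $|(N(U) \cup N(W)) \setminus (U \cup W)| = k$. Then $$\limsup_{n\to\infty} \frac{\operatorname{csat}(n,F)}{n} \leq k + \frac{r-1}{2}.$$
   Context: All graphs are simple, finite and undirected, and have at least one edge. For a vertex set $S$ of $F$, $N(S)$ denotes the set of vertices of $F$ adjacent to at least one vertex of $S$. A "copy of $F$" in $G$ is a (not necessarily induced) subgraph of $G$ isomorphic to $F$. A graph $G$ is $F$-covered if every edge of $G$ lies in a copy of $F$ in $G$. A graph $G$ is $F$-semi-saturated if for every edge $e$ of the complement of $G$, the graph $G+e$ contains more copies of $F$ than $G$ does (equivalently, $G+e$ contains a copy of $F$ using $e$). A graph is $F$-cov-sat if it is both $F$-covered and $F$-semi-saturated. For $n \geq |F|$ (where $|F|$ is the number of vertices of $F$), $\operatorname{csat}(n,F)$ is the minimum number of edges of an $F$-cov-sat graph on exactly $n$ vertices. *)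

theory Defs
  imports Complex_Main "HOL-Library.Extended_Real" "HOL-Library.Liminf_Limsup"
begin

record 'a ugraph =
  verts :: "'a set"
  edges :: "'a set set"

definition vertex_pairs :: "'a set \<Rightarrow> 'a set set" where
  "vertex_pairs V = {e. e \<subseteq> V \<and> card e = 2}"

text \<open>Finite simple undirected graphs; by convention a graph has at least one edge.\<close>

definition is_graph :: "'a ugraph \<Rightarrow> bool" where
  "is_graph G \<longleftrightarrow> finite (verts G) \<and> edges G \<subseteq> vertex_pairs (verts G) \<and> edges G \<noteq> {}"

definition nbhd :: "'a ugraph \<Rightarrow> 'a set \<Rightarrow> 'a set" where
  "nbhd G S = {v \<in> verts G. \<exists>s\<in>S. {s, v} \<in> edges G}"

definition subgraph :: "'a ugraph \<Rightarrow> 'a ugraph \<Rightarrow> bool" where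
  "subgraph H G \<longleftrightarrow> is_graph H \<and> verts H \<subseteq> verts G \<and> edges H \<subseteq> edges G"

definition isomorphic :: "'a ugraph \<Rightarrow> 'b ugraph \<Rightarrow> bool" where
  "isomorphic G H \<longleftrightarrow>
     (\<exists>f. bij_betw f (verts G) (verts H) \<and>
          (\<forall>u\<in>verts G. \<forall>v\<in>verts G. {u, v} \<in> edges G \<longleftrightarrow> {f u, f v} \<in> edges H))"

text \<open>A copy is a subgraph, not an embedding: embeddings with the same image are
  the same copy. Copies need not be induced.\<close>

definition copies :: "'a ugraph \<Rightarrow> 'b ugraph \<Rightarrow> 'b ugraph set" where
  "copies F G = {H. subgraph H G \<and> isomorphic F H}"

definition add_edge :: "'a ugraph \<Rightarrow> 'a set \<Rightarrow> 'a ugraph" where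
  "add_edge G e = \<lparr>verts = verts G, edges = insert e (edges G)\<rparr>"

definition covered :: "'a ugraph \<Rightarrow> 'b ugraph \<Rightarrow> bool" where
  "covered F G \<longleftrightarrow> (\<forall>e\<in>edges G. \<exists>H\<in>copies F G. e \<in> edges H)"

definition semi_saturated :: "'a ugraph \<Rightarrow> 'b ugraph \<Rightarrow> bool" where
  "semi_saturated F G \<longleftrightarrow>
     (\<forall>e \<in> vertex_pairs (verts G) - edges G. card (copies F (add_edge G e)) > card (copies F G))"

definition cov_sat :: "'a ugraph \<Rightarrow> 'b ugraph \<Rightarrow> bool" where
  "cov_sat F G \<longleftrightarrow> covered F G \<and> semi_saturated F G"

text \<open>Taking vertices of type \<^typ>\<open>nat\<close> loses no isomorphism type. For
  \<open>n \<ge> card (verts F)\<close> the minimum exists, as the complete graph on \<open>n\<close> vertices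
  qualifies; for smaller \<open>n\<close> the value is unspecified.\<close>

definition csat :: "nat \<Rightarrow> 'a ugraph \<Rightarrow> nat" where
  "csat n F = (LEAST m. \<exists>G :: nat ugraph.
     is_graph G \<and> card (verts G) = n \<and> cov_sat F G \<and> card (edges G) = m)"

end

theory Submission imports Defs begin

text \<open>
  Write \<open>N = (N(U) \<union> N(W)) - (U \<union> W)\<close>, so that \<open>|N| = k\<close>, and let \<open>uw\<close> be the only edge
  between \<open>U\<close> and \<open>W\<close>.  The bound is witnessed by a \<^emph>\<open>hub graph\<close>: a clique \<open>C\<close> (the core) with
  at least \<open>|F|\<close> but fewer than \<open>|F| + r\<close> vertices, a set \<open>K \<subseteq> C\<close> of \<open>k\<close> hubs, disjoint cliques
  on \<open>r\<close> vertices each (the outer blocks) on all the other vertices, and all edges between hubs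
  and outer blocks.  An outer vertex accounts for \<open>k\<close> edges to hubs and for \<open>(r - 1)/2\<close> edges of its
  block, and the core contributes a bounded number of edges.

  Such a graph is \<open>F\<close>-cov-sat because \<open>N\<close> separates \<open>U \<union> W\<close> from the rest of \<open>F\<close>.  Put \<open>N\<close> on the
  hubs, the rest of \<open>F\<close> on the core, \<open>U\<close> in an outer block \<open>A\<close> and \<open>W\<close> in a block \<open>B\<close>: every edge of \<open>F\<close>
  then lies inside a block or has an end that is a hub, except \<open>uw\<close>, which joins \<open>A\<close> to \<open>B\<close>.  If
  \<open>A = B\<close>, there is no exception; there is room for all of \<open>U \<union> W\<close> in the block, and this
  covers the edges that have an end in an outer block.  If \<open>A \<noteq> B\<close>, the exceptional edge can be
  placed on any prescribed missing edge between the two blocks, which gives semi-saturation.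
  Edges inside the core are covered by copies of \<open>F\<close> in the core.

  All these placements come from one principle (\<open>fibrewise_injection_extends\<close>): vertices of \<open>F\<close>
  and of the hub graph are labelled, and a label-preserving injection exists, with the images of an
  edge prescribed, as soon as no label occurs more often in \<open>F\<close> than in the hub graph.
\<close>

section \<open>Label-preserving injections and copies\<close>

text \<open>
  The labels can be treated one at a time: within a fibre, the prescribed injection removes equally
  many elements from both sides, so what remains still fits.
\<close>

lemma fibrewise_injection_extends:
  assumes finX: "finite X" and finY: "finite Y"
    and le: "\<And>x. x \<in> X \<Longrightarrow> card {z\<in>X. p z = p x} \<le> card {y\<in>Y. q y = p x}"
    and X0: "X0 \<subseteq> X" and inj: "inj_on g X0"
    and g: "\<And>x. x \<in> X0 \<Longrightarrow> g x \<in> Y \<and> q (g x) = p x"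
  shows "\<exists>f. inj_on f X \<and> f ` X \<subseteq> Y \<and> (\<forall>x\<in>X. q (f x) = p x) \<and> (\<forall>x\<in>X0. f x = g x)"
proof -
  define A where "A i = {x\<in>X. p x = i} - X0" for i
  define B where "B i = {y\<in>Y. q y = i} - g ` X0" for i
  have "\<exists>h. h ` A i \<subseteq> B i \<and> inj_on h (A i)" for i
  proof (cases "A i = {}")
    case False
    then obtain x where x: "x \<in> X" "p x = i" by (auto simp: A_def)
    define Z where "Z = {x\<in>X0. p x = i}"
    have Z: "finite Z" "Z \<subseteq> {x\<in>X. p x = i}" "g ` Z \<subseteq> {y\<in>Y. q y = i}"
      using X0 finX g by (auto simp: Z_def intro: finite_subset)
    have "A i = {x\<in>X. p x = i} - Z" by (auto simp: A_def Z_def)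
    then have "card (A i) = card {x\<in>X. p x = i} - card Z"
      using Z by (simp add: card_Diff_subset)
    moreover have "B i = {y\<in>Y. q y = i} - g ` Z" using g by (auto simp: B_def Z_def)
    then have "card (B i) = card {y\<in>Y. q y = i} - card (g ` Z)"
      using Z by (simp add: card_Diff_subset)
    moreover have "card (g ` Z) = card Z"
      using inj by (intro card_image) (auto simp: Z_def inj_on_def)
    ultimately have "card (A i) \<le> card (B i)" using le[OF x(1)] x(2) by simp
    then show ?thesis using finX finY by (intro card_le_inj) (auto simp: A_def B_def)
  qed auto
  then obtain h where h: "\<And>i. h i ` A i \<subseteq> B i" "\<And>i. inj_on (h i) (A i)" by metis
  define f where "f x = (if x \<in> X0 then g x else h (p x) x)" for x
  have out: "f x \<in> Y \<and> q (f x) = p x \<and> f x \<notin> g ` X0 \<and> f x = h (p x) x \<and> x \<in> A (p x)"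
    if "x \<in> X - X0" for x
  proof -
    have "x \<in> A (p x)" using that by (auto simp: A_def)
    then show ?thesis using h(1)[of "p x"] that by (auto simp: f_def B_def)
  qed
  have "inj_on f X"
  proof (rule inj_onI)
    fix x y assume xy: "x \<in> X" "y \<in> X" "f x = f y"
    consider "x \<in> X0" "y \<in> X0" | "x \<in> X0" "y \<notin> X0" | "x \<notin> X0" "y \<in> X0" | "x \<notin> X0" "y \<notin> X0"
      by blast
    then show "x = y"
    proof cases
      case 1 then show ?thesis using xy inj by (auto simp: f_def inj_on_def)
    next
      case 2 then show ?thesis using xy out[of y] by (metis DiffI f_def imageI)
    next
      case 3 then show ?thesis using xy out[of x] by (metis DiffI f_def imageI)
    next
      case 4
      then show ?thesis using xy out[of x] out[of y] h(2)[of "p x"] by (metis DiffI inj_onD)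
    qed
  qed
  moreover have "f x \<in> Y \<and> q (f x) = p x" if "x \<in> X" for x
    using out[of x] g[of x] that by (cases "x \<in> X0") (auto simp: f_def)
  moreover have "f x = g x" if "x \<in> X0" for x using that by (simp add: f_def)
  ultimately show ?thesis by (intro exI[of _ f]) blast
qed

lemma is_graph_edgeE:
  assumes "is_graph G" "e \<in> edges G"
  obtains x y where "e = {x, y}" "x \<in> verts G" "y \<in> verts G" "x \<noteq> y"
proof -
  have "e \<subseteq> verts G" "card e = 2"
    using assms by (auto simp: is_graph_def vertex_pairs_def)
  then show thesis using that by (auto simp: card_2_iff)
qed

lemma copy_of_embedding:
  assumes F: "is_graph F" and inj: "inj_on f (verts F)" and ran: "f ` verts F \<subseteq> verts G"
    and hom: "\<And>e. e \<in> edges F \<Longrightarrow> f ` e \<in> edges G" and e0: "e0 \<in> edges F"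
  shows "\<exists>H\<in>copies F G. f ` e0 \<in> edges H"
proof -
  define H where "H = \<lparr>verts = f ` verts F, edges = (`) f ` edges F\<rparr>"
  have sub: "e \<subseteq> verts F" if "e \<in> edges F" for e
    using F that by (auto simp: is_graph_def vertex_pairs_def)
  have "card (f ` e) = 2" if "e \<in> edges F" for e
    using F that inj inj_on_subset[OF inj sub[OF that]]
    by (auto simp: is_graph_def vertex_pairs_def card_image)
  then have "is_graph H"
    using F sub by (fastforce simp: is_graph_def vertex_pairs_def H_def)
  moreover have "{u, v} \<in> edges F \<longleftrightarrow> {f u, f v} \<in> edges H"
    if "u \<in> verts F" "v \<in> verts F" for u v
  proof
    assume "{u, v} \<in> edges F"
    then have "f ` {u, v} \<in> edges H" unfolding H_def by (simp del: image_insert)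
    then show "{f u, f v} \<in> edges H" by simp
  next
    assume "{f u, f v} \<in> edges H"
    then obtain e where e: "e \<in> edges F" "f ` {u, v} = f ` e" by (auto simp: H_def)
    then have "{u, v} = e"
      using inj_on_image_eq_iff[OF inj _ sub[OF e(1)], of "{u, v}"] that by simp
    then show "{u, v} \<in> edges F" using e by simp
  qed
  ultimately have "H \<in> copies F G"
    using ran hom inj unfolding copies_def subgraph_def isomorphic_def
    by (auto simp: H_def bij_betw_def)
  moreover have "f ` e0 \<in> edges H" using e0 by (simp add: H_def)
  ultimately show ?thesis by blast
qed

lemma finite_copies:
  assumes "finite (verts G)" "finite (edges G)"
  shows "finite (copies F G)"
proof (rule finite_subset)
  show "copies F G \<subseteq> (\<lambda>(V, E). \<lparr>verts = V, edges = E\<rparr>) ` (Pow (verts G) \<times> Pow (edges G))"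
  proof
    fix H assume "H \<in> copies F G"
    then show "H \<in> (\<lambda>(V, E). \<lparr>verts = V, edges = E\<rparr>) ` (Pow (verts G) \<times> Pow (edges G))"
      by (cases H) (auto simp: copies_def subgraph_def)
  qed
qed (use assms in auto)

lemma is_graph_finite_edges: "is_graph G \<Longrightarrow> finite (edges G)"
  by (rule finite_subset[of _ "Pow (verts G)"]) (auto simp: is_graph_def vertex_pairs_def)

text \<open>
  The number of copies grows strictly as soon as one copy uses the new edge: old copies survive
  and do not contain it, and finiteness turns proper inclusion into a strict inequality.
\<close>

lemma semi_saturatedI:
  assumes G: "is_graph G"
    and new: "\<And>e. e \<in> vertex_pairs (verts G) - edges G \<Longrightarrow>
      \<exists>H\<in>copies F (add_edge G e). e \<in> edges H"
  shows "semi_saturated F G"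
  unfolding semi_saturated_def
proof
  fix e assume e: "e \<in> vertex_pairs (verts G) - edges G"
  obtain H where "H \<in> copies F (add_edge G e)" "e \<in> edges H" using new[OF e] by blast
  moreover from this have "H \<notin> copies F G" using e by (auto simp: copies_def subgraph_def)
  moreover have "copies F G \<subseteq> copies F (add_edge G e)"
    by (auto simp: copies_def subgraph_def add_edge_def)
  ultimately have "copies F G \<subset> copies F (add_edge G e)" by blast
  moreover have "finite (copies F (add_edge G e))"
    using G is_graph_finite_edges[OF G]
    by (intro finite_copies) (auto simp: add_edge_def is_graph_def)
  ultimately show "card (copies F G) < card (copies F (add_edge G e))"
    by (rule psubset_card_mono[rotated])
qed

section \<open>Hub graphs are cov-sat\<close>

definition hub_graph :: "'b set \<Rightarrow> 'b set \<Rightarrow> ('b \<Rightarrow> 'i) \<Rightarrow> 'b ugraph" where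
  "hub_graph V K b = \<lparr>verts = V,
     edges = {{x, y} | x y. x \<in> V \<and> y \<in> V \<and> x \<noteq> y \<and> (b x = b y \<or> x \<in> K \<or> y \<in> K)}\<rparr>"

lemma verts_hub_graph [simp]: "verts (hub_graph V K b) = V"
  by (simp add: hub_graph_def)

lemma hub_graph_edge_iff:
  "{x, y} \<in> edges (hub_graph V K b) \<longleftrightarrow>
     x \<in> V \<and> y \<in> V \<and> x \<noteq> y \<and> (b x = b y \<or> x \<in> K \<or> y \<in> K)"
  by (auto simp: hub_graph_def doubleton_eq_iff)

text \<open>
  The blocks of \<open>V\<close> are the fibres of \<open>b\<close>, and \<open>core\<close> is the label of the block that contains the
  hubs.  Lower bounds on the block sizes suffice for the cov-sat property.
\<close>

locale hub_construction =
  fixes F :: "'a ugraph" and U W N :: "'a set" and u w :: 'a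
    and V K :: "'b set" and b :: "'b \<Rightarrow> 'i" and core :: 'i
  assumes F: "is_graph F" and UF: "U \<subseteq> verts F" and WF: "W \<subseteq> verts F" and UW: "U \<inter> W = {}"
    and uU: "u \<in> U" and wW: "w \<in> W" and uw: "{u, w} \<in> edges F"
    and only_uw: "\<And>s t. s \<in> U \<Longrightarrow> t \<in> W \<Longrightarrow> {s, t} \<in> edges F \<Longrightarrow> {s, t} = {u, w}"
    and N_eq: "N = (nbhd F U \<union> nbhd F W) - (U \<union> W)"
    and finV: "finite V" and KV: "K \<subseteq> V" and K_core: "\<And>v. v \<in> K \<Longrightarrow> b v = core"
    and card_K: "card K = card N"
    and core_large: "card (verts F) \<le> card {v\<in>V. b v = core}"
    and blocks_large: "\<And>x. x \<in> V \<Longrightarrow> b x \<noteq> core \<Longrightarrow> card (U \<union> W) \<le> card {v\<in>V. b v = b x}"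
begin

abbreviation G where "G \<equiv> hub_graph V K b"

text \<open>
  The two labellings give hubs, and the vertices of \<open>F\<close> destined for hubs, the label \<open>None\<close>
  of their own, although hubs lie in the core: only hubs are joined to every other vertex, and the
  placement must not spend them on vertices outside \<open>N\<close>.
\<close>

definition place :: "'i \<Rightarrow> 'i \<Rightarrow> 'a \<Rightarrow> 'i option" where
  "place A B v =
     (if v \<in> N then None else if v \<in> U then Some A else if v \<in> W then Some B else Some core)"

definition kind :: "'b \<Rightarrow> 'i option" where
  "kind x = (if x \<in> K then None else Some (b x))"

lemma finF: "finite (verts F)"
  using F by (simp add: is_graph_def)

lemma NF: "N \<subseteq> verts F"
  by (auto simp: N_eq nbhd_def)

lemma N_disj: "v \<in> N \<Longrightarrow> v \<notin> U \<and> v \<notin> W"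
  by (auto simp: N_eq)

text \<open>No edge leaves \<open>U \<union> W\<close> except to \<open>N\<close>, so \<open>uw\<close> is the only edge that can join two blocks.\<close>

lemma place_edge:
  assumes "{s, t} \<in> edges F"
  shows "place A B s = None \<or> place A B t = None \<or> place A B s = place A B t \<or> {s, t} = {u, w}"
proof -
  have st: "s \<in> verts F" "t \<in> verts F"
    using F assms by (auto simp: is_graph_def vertex_pairs_def)
  have ts: "{t, s} \<in> edges F" using assms by (simp add: insert_commute)
  have "t \<in> N" if "s \<in> U \<union> W" "t \<notin> U \<union> W"
    using that assms st by (auto simp: N_eq nbhd_def)
  moreover have "s \<in> N" if "t \<in> U \<union> W" "s \<notin> U \<union> W"
    using that ts st by (auto simp: N_eq nbhd_def)
  moreover have "{s, t} = {u, w}" if "s \<in> U \<and> t \<in> W \<or> s \<in> W \<and> t \<in> U"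
    using that only_uw[of s t] only_uw[of t s] assms ts by (metis insert_commute)
  ultimately show ?thesis unfolding place_def by auto
qed

text \<open>
  There is room for each part of \<open>F\<close>.  The block \<open>A\<close> receiving \<open>U\<close> has to be outer; the block \<open>B\<close>
  receiving \<open>W\<close> may be the core, since the core has at least as many non-hubs as \<open>F\<close> has vertices
  outside \<open>N\<close>.
\<close>

lemma place_fits:
  assumes A: "A \<in> b ` V" "A \<noteq> core" and B: "B \<in> b ` V" and z: "z \<in> verts F"
  shows "card {v\<in>verts F. place A B v = place A B z} \<le> card {y\<in>V. kind y = place A B z}"
proof (cases "place A B z")
  case None
  have "{v\<in>verts F. place A B v = None} = N" using NF by (auto simp: place_def)
  moreover have "{y\<in>V. kind y = None} = K" using KV by (auto simp: kind_def)
  ultimately show ?thesis using card_K None by simp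
next
  case (Some i)
  show ?thesis
  proof (cases "i = core")
    case True
    have "card {v\<in>verts F. place A B v = Some core} \<le> card (verts F - N)"
      using finF by (intro card_mono) (auto simp: place_def)
    also have "\<dots> = card (verts F) - card K"
      using NF finF card_K by (simp add: card_Diff_subset finite_subset)
    also have "\<dots> \<le> card {v\<in>V. b v = core} - card K"
      using core_large by simp
    also have "\<dots> = card ({v\<in>V. b v = core} - K)"
      using KV K_core finV by (intro card_Diff_subset[symmetric]) (auto intro: finite_subset)
    also have "{v\<in>V. b v = core} - K = {y\<in>V. kind y = Some core}"
      by (auto simp: kind_def)
    finally show ?thesis using Some True by simp
  next
    case False
    then have i: "i \<in> b ` V" using Some A B by (auto simp: place_def split: if_splits)
    have "card {v\<in>verts F. place A B v = Some i} \<le> card (U \<union> W)"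
      using False UF WF finF
      by (intro card_mono) (auto simp: place_def finite_subset split: if_splits)
    also have "\<dots> \<le> card {v\<in>V. b v = i}"
      using i blocks_large False by auto
    also have "{v\<in>V. b v = i} = {y\<in>V. kind y = Some i}"
      using K_core False by (auto simp: kind_def)
    finally show ?thesis using Some by simp
  qed
qed

text \<open>
  If \<open>A = B\<close> the copy lies in \<open>G\<close> itself; the edge \<open>{x, y}\<close> is then already present, and adding it
  changes nothing.
\<close>

lemma copy_through:
  assumes A: "A \<in> b ` V" "A \<noteq> core" and B: "B \<in> b ` V"
    and st: "{s, t} \<in> edges F" "A = B \<or> {s, t} = {u, w}"
    and xy: "x \<in> V" "y \<in> V" "x \<noteq> y" "kind x = place A B s" "kind y = place A B t"
  shows "\<exists>H\<in>copies F (add_edge G {x, y}). {x, y} \<in> edges H"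
proof -
  have stF: "s \<in> verts F" "t \<in> verts F" "s \<noteq> t"
    using F st(1) by (auto simp: is_graph_def vertex_pairs_def)
  define g where "g = (\<lambda>v. if v = s then x else y)"
  have "\<exists>f. inj_on f (verts F) \<and> f ` verts F \<subseteq> V \<and>
      (\<forall>v\<in>verts F. kind (f v) = place A B v) \<and> (\<forall>v\<in>{s, t}. f v = g v)"
    using stF xy
    by (intro fibrewise_injection_extends finF finV place_fits[OF A B])
      (auto simp: g_def inj_on_def)
  then obtain f where f: "inj_on f (verts F)" "f ` verts F \<subseteq> V"
      "\<And>v. v \<in> verts F \<Longrightarrow> kind (f v) = place A B v" "f s = x" "f t = y"
    using stF by (auto simp: g_def)
  have hom: "f ` e \<in> edges (add_edge G {x, y})" if e: "e \<in> edges F" for e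
  proof -
    obtain c d where cd: "e = {c, d}" "c \<in> verts F" "d \<in> verts F" "c \<noteq> d"
      using is_graph_edgeE[OF F e] by blast
    have V: "f c \<in> V" "f d \<in> V" "f c \<noteq> f d"
      using cd f(1,2) by (auto simp: inj_on_def)
    have "place A B c = None \<or> place A B d = None \<or> place A B c = place A B d
        \<or> A \<noteq> B \<and> {c, d} = {u, w}"
    proof (cases "A = B \<and> {c, d} = {u, w}")
      case True
      then have "place A B c = place A B d"
        using uU wW UW N_disj by (auto simp: place_def doubleton_eq_iff)
      then show ?thesis by blast
    next
      case False
      moreover have "{c, d} \<in> edges F" using e cd(1) by simp
      ultimately show ?thesis using place_edge[of c d A B] by metis
    qed
    then consider "kind (f c) = None \<or> kind (f d) = None \<or> kind (f c) = kind (f d)"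
      | "A \<noteq> B" "{c, d} = {u, w}"
      using f(3) cd by metis
    then show ?thesis
    proof cases
      case 1
      then have "{f c, f d} \<in> edges G"
        using V by (auto simp: hub_graph_edge_iff kind_def split: if_splits)
      then show ?thesis using cd by (simp add: add_edge_def)
    next
      case 2
      then have "f ` e = f ` {s, t}" using st cd by metis
      then show ?thesis using f by (simp add: add_edge_def)
    qed
  qed
  have "\<exists>H\<in>copies F (add_edge G {x, y}). f ` {s, t} \<in> edges H"
    using f(2) hom st(1) by (intro copy_of_embedding[OF F f(1)]) (auto simp: add_edge_def)
  then show ?thesis using f by simp
qed

lemma core_edge_covered:
  assumes xy: "x \<in> V" "y \<in> V" "x \<noteq> y" and core: "b x = core" "b y = core"
  shows "\<exists>H\<in>copies F G. {x, y} \<in> edges H"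
proof -
  have ne: "u \<in> verts F" "w \<in> verts F" "u \<noteq> w" using uU wW UW UF WF by auto
  define g where "g = (\<lambda>v. if v = u then x else y)"
  have "\<exists>f. inj_on f (verts F) \<and> f ` verts F \<subseteq> V \<and>
      (\<forall>v\<in>verts F. b (f v) = core) \<and> (\<forall>v\<in>{u, w}. f v = g v)"
    using ne xy core core_large
    by (intro fibrewise_injection_extends finF finV) (auto simp: g_def inj_on_def)
  then obtain f where f: "inj_on f (verts F)" "f ` verts F \<subseteq> V"
      "\<And>v. v \<in> verts F \<Longrightarrow> b (f v) = core" "f u = x" "f w = y"
    using ne by (auto simp: g_def)
  have "f ` e \<in> edges G" if e: "e \<in> edges F" for e
  proof -
    obtain c d where cd: "e = {c, d}" "c \<in> verts F" "d \<in> verts F" "c \<noteq> d"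
      using is_graph_edgeE[OF F e] by blast
    then show ?thesis using f by (auto simp: hub_graph_edge_iff inj_on_def)
  qed
  then have "\<exists>H\<in>copies F G. f ` {u, w} \<in> edges H"
    using f(2) uw by (intro copy_of_embedding[OF F f(1)]) auto
  then show ?thesis using f by simp
qed

lemma outer_edge_covered:
  assumes xy: "{x, y} \<in> edges G" and outer: "b x \<noteq> core"
  shows "\<exists>H\<in>copies F G. {x, y} \<in> edges H"
proof -
  have V: "x \<in> V" "y \<in> V" "x \<noteq> y" and near: "b x = b y \<or> x \<in> K \<or> y \<in> K"
    using xy by (simp_all add: hub_graph_edge_iff)
  have xK: "x \<notin> K" using K_core outer by blast
  have adj: "b x = b y \<or> y \<in> K" using near xK by blast
  have "\<exists>s t. {s, t} \<in> edges F \<and> place (b x) (b x) s = kind x \<and> place (b x) (b x) t = kind y"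
  proof (cases "y \<in> K")
    case True
    \<comment> \<open>A hub exists only if \<open>N\<close> is nonempty, and a vertex of \<open>N\<close> has a neighbour in \<open>U \<union> W\<close>.\<close>
    then have "card K \<noteq> 0" using finite_subset[OF KV finV] by auto
    then have "N \<noteq> {}" using card_K by auto
    then obtain t where t: "t \<in> N" by blast
    then obtain s where s: "s \<in> U \<union> W" "{s, t} \<in> edges F" by (auto simp: N_eq nbhd_def)
    then have "place (b x) (b x) s = kind x" "place (b x) (b x) t = kind y"
      using t True xK N_disj[of s] by (auto simp: place_def kind_def)
    then show ?thesis using s by blast
  next
    case False
    then have "place (b x) (b x) u = kind x" "place (b x) (b x) w = kind y"
      using uU wW N_disj[of u] N_disj[of w] xK adj by (auto simp: place_def kind_def)
    then show ?thesis using uw by blast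
  qed
  then obtain s t where "{s, t} \<in> edges F" "place (b x) (b x) s = kind x"
      "place (b x) (b x) t = kind y" by blast
  then have "\<exists>H\<in>copies F (add_edge G {x, y}). {x, y} \<in> edges H"
    using V outer by (intro copy_through[of "b x" "b x" s t]) auto
  moreover have "add_edge G {x, y} = G" using xy by (simp add: add_edge_def insert_absorb)
  ultimately show ?thesis by simp
qed

lemma missing_edge_copy:
  assumes xy: "x \<in> V" "y \<in> V" "x \<noteq> y" "{x, y} \<notin> edges G" and outer: "b x \<noteq> core"
  shows "\<exists>H\<in>copies F (add_edge G {x, y}). {x, y} \<in> edges H"
proof -
  have "b x \<noteq> b y" "x \<notin> K" "y \<notin> K" using xy by (simp_all add: hub_graph_edge_iff)
  then have "kind x = place (b x) (b y) u" "kind y = place (b x) (b y) w"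
    using uU wW UW N_disj[of u] N_disj[of w] by (auto simp: place_def kind_def)
  then show ?thesis using xy(1-3) outer uw
    by (intro copy_through[of "b x" "b y" u w]) auto
qed

lemma is_graph_G: "is_graph G"
proof -
  have "2 \<le> card (verts F)"
  proof -
    have "u \<noteq> w" "{u, w} \<subseteq> verts F" using uU wW UF WF UW by blast+
    then show ?thesis using card_mono[OF finF, of "{u, w}"] by simp
  qed
  then have "2 \<le> card {v\<in>V. b v = core}" using core_large by simp
  then obtain T where T: "T \<subseteq> {v\<in>V. b v = core}" "card T = 2"
    using obtain_subset_with_card_n by metis
  then obtain x y where "T = {x, y}" "x \<noteq> y" by (auto simp: card_2_iff)
  with T have "x \<in> V" "y \<in> V" "b x = core" "b y = core" "x \<noteq> y" by auto
  then have "{x, y} \<in> edges G" by (simp add: hub_graph_edge_iff)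
  then show ?thesis using finV by (auto simp: is_graph_def vertex_pairs_def hub_graph_def)
qed

lemma cov_sat_G: "cov_sat F G"
  unfolding cov_sat_def
proof
  show "covered F G" unfolding covered_def
  proof
    fix e assume e: "e \<in> edges G"
    obtain x y where xy: "e = {x, y}" "x \<in> V" "y \<in> V" "x \<noteq> y"
      using is_graph_edgeE[OF is_graph_G e] by auto
    show "\<exists>H\<in>copies F G. e \<in> edges H"
      using core_edge_covered[of x y] outer_edge_covered[of x y] outer_edge_covered[of y x] xy e
      by (metis insert_commute)
  qed
next
  show "semi_saturated F G"
  proof (rule semi_saturatedI[OF is_graph_G])
    fix e assume e: "e \<in> vertex_pairs (verts G) - edges G"
    then obtain x y where xy: "e = {x, y}" "x \<in> V" "y \<in> V" "x \<noteq> y"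
      by (auto simp: vertex_pairs_def card_2_iff)
    moreover have "b x \<noteq> core \<or> b y \<noteq> core"
      using e xy hub_graph_edge_iff[of x y V K b] by force
    ultimately show "\<exists>H\<in>copies F (add_edge G e). e \<in> edges H"
      using missing_edge_copy[of x y] missing_edge_copy[of y x] e by (metis DiffD2 insert_commute)
  qed
qed

end

section \<open>Counting edges\<close>

text \<open>
  The core is the initial segment of length \<open>c\<close>, with label \<open>0\<close>; the outer blocks are the
  following intervals of length \<open>r\<close>.
\<close>

definition interval_block :: "nat \<Rightarrow> nat \<Rightarrow> nat \<Rightarrow> nat" where
  "interval_block c r v = (if v < c then 0 else Suc ((v - c) div r))"

lemma interval_block_core: "c \<le> n \<Longrightarrow> {v\<in>{..<n}. interval_block c r v = 0} = {..<c}"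
  by (auto simp: interval_block_def)

lemma interval_block_outer:
  assumes "0 < r" "i < m"
  shows "{v\<in>{..<c + m * r}. interval_block c r v = Suc i} = {c + i * r..<c + Suc i * r}"
proof -
  have iff: "interval_block c r v = Suc i \<longleftrightarrow> c + i * r \<le> v \<and> v < c + Suc i * r" for v
  proof -
    have "(v - c) div r = i \<longleftrightarrow> i \<le> (v - c) div r \<and> (v - c) div r < Suc i" by linarith
    also have "\<dots> \<longleftrightarrow> i * r \<le> v - c \<and> v - c < Suc i * r"
      by (simp only: less_eq_div_iff_mult_less_eq[OF assms(1)] div_less_iff_less_mult[OF assms(1)])
    finally have eq: "(v - c) div r = i \<longleftrightarrow> i * r \<le> v - c \<and> v - c < Suc i * r" .
    have "interval_block c r v = Suc i \<longleftrightarrow> c \<le> v \<and> (v - c) div r = i"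
      by (auto simp: interval_block_def)
    then show ?thesis unfolding eq by auto
  qed
  have "Suc i * r \<le> m * r" using assms(2) by (intro mult_le_mono1) simp
  then show ?thesis unfolding iff by auto
qed

lemma card_edges_hub_graph_le:
  assumes r: "0 < r" and kc: "k \<le> c"
  shows "real (card (edges (hub_graph {..<c + m * r} {..<k} (interval_block c r))))
    \<le> 2 ^ c + real (m * r) * (real k + (real r - 1) / 2)"
proof -
  define B where "B i = {c + i * r..<c + Suc i * r}" for i
  \<comment> \<open>The core stays bounded as \<open>m\<close> grows, so all its subsets may be counted instead of its
    edges.\<close>
  define E1 where "E1 = Pow {..<c}"
  define E2 where "E2 = (\<lambda>(x, y). {x, y}) ` ({..<k} \<times> {c..<c + m * r})"
  define E3 where "E3 = (\<Union>i<m. {e. e \<subseteq> B i \<and> card e = 2})"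
  have fin: "finite E1" "finite E2" "finite E3"
    by (auto simp: E1_def E2_def E3_def B_def)
  have sub: "edges (hub_graph {..<c + m * r} {..<k} (interval_block c r)) \<subseteq> E1 \<union> E2 \<union> E3"
  proof
    fix e assume "e \<in> edges (hub_graph {..<c + m * r} {..<k} (interval_block c r))"
    then obtain x y where e: "e = {x, y}" "x \<noteq> y" "x < c + m * r" "y < c + m * r"
      and adj: "interval_block c r x = interval_block c r y \<or> x < k \<or> y < k"
      by (auto simp: hub_graph_def)
    consider "x < c" "y < c" | "x < k" "y \<ge> c" | "y < k" "x \<ge> c"
      | "x \<ge> c" "y \<ge> c" "interval_block c r x = interval_block c r y"
      using adj kc by (auto simp: interval_block_def split: if_splits)
    then show "e \<in> E1 \<union> E2 \<union> E3"
    proof cases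
      case 1 then show ?thesis using e by (auto simp: E1_def)
    next
      case 2
      then have "(x, y) \<in> {..<k} \<times> {c..<c + m * r}" using e by auto
      then have "e \<in> E2" unfolding E2_def e by (rule rev_image_eqI) auto
      then show ?thesis by blast
    next
      case 3
      then have "(y, x) \<in> {..<k} \<times> {c..<c + m * r}" using e by auto
      then have "e \<in> E2" unfolding E2_def e by (rule rev_image_eqI) auto
      then show ?thesis by blast
    next
      case 4
      define i where "i = (x - c) div r"
      have i: "i < m" using e 4 r by (auto simp: i_def less_mult_imp_div_less)
      have "interval_block c r x = Suc i" "interval_block c r y = Suc i"
        using 4 by (auto simp: i_def interval_block_def)
      then have "x \<in> B i" "y \<in> B i"
        using interval_block_outer[OF r i, of c] e unfolding B_def by blast+
      then show ?thesis using e i by (auto simp: E3_def)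
    qed
  qed
  have "card E1 = 2 ^ c" by (simp add: E1_def card_Pow)
  moreover have "card E2 \<le> k * (m * r)"
    unfolding E2_def by (rule order.trans[OF card_image_le]) auto
  moreover have "card E3 \<le> m * (r choose 2)"
  proof -
    have "card E3 \<le> (\<Sum>i<m. card {e. e \<subseteq> B i \<and> card e = 2})"
      unfolding E3_def by (intro card_UN_le) auto
    also have "\<dots> = (\<Sum>i<m. r choose 2)"
      by (intro sum.cong refl) (subst n_subsets, auto simp: B_def)
    finally show ?thesis by simp
  qed
  moreover have "card (edges (hub_graph {..<c + m * r} {..<k} (interval_block c r)))
      \<le> card E1 + card E2 + card E3"
    using card_mono[OF _ sub] fin card_Un_le[of E1 E2] card_Un_le[of "E1 \<union> E2" E3] by fastforce
  ultimately have "card (edges (hub_graph {..<c + m * r} {..<k} (interval_block c r)))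
      \<le> 2 ^ c + k * (m * r) + m * (r choose 2)" by linarith
  then have "real (card (edges (hub_graph {..<c + m * r} {..<k} (interval_block c r))))
      \<le> real (2 ^ c + k * (m * r) + m * (r choose 2))" by (rule of_nat_mono)
  also have "real (r choose 2) = real r * (real r - 1) / 2"
  proof -
    have "even (r * (r - 1))" by (cases r) auto
    then have "2 * (r choose 2) = r * (r - 1)"
      unfolding choose_two by (rule dvd_mult_div_cancel)
    then have "2 * real (r choose 2) = real r * real (r - 1)" by (metis of_nat_mult of_nat_numeral)
    then show ?thesis using r by (simp add: of_nat_diff)
  qed
  then have "real (2 ^ c + k * (m * r) + m * (r choose 2))
      = 2 ^ c + real (m * r) * (real k + (real r - 1) / 2)"
    by (simp only: of_nat_add of_nat_mult of_nat_power of_nat_numeral) (simp add: field_simps)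
  finally show ?thesis .
qed

section \<open>The asymptotic bound\<close>

lemma csat_le:
  fixes G :: "nat ugraph"
  assumes "is_graph G" "card (verts G) = n" "cov_sat F G"
  shows "csat n F \<le> card (edges G)"
  unfolding csat_def using assms by (intro Least_le) blast

lemma limsup_ratio_le:
  fixes a :: "nat \<Rightarrow> nat" and C L :: real
  assumes "\<And>n. n \<ge> n0 \<Longrightarrow> real (a n) \<le> C + real n * L"
  shows "limsup (\<lambda>n. ereal (real (a n) / real n)) \<le> ereal L"
proof -
  have "eventually (\<lambda>n. ereal (real (a n) / real n) \<le> ereal (C / real n + L)) sequentially"
    using eventually_ge_at_top[of "max n0 1"]
  proof eventually_elim
    case (elim n)
    then have "real (a n) / real n \<le> (C + real n * L) / real n"
      by (intro divide_right_mono assms) auto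
    then show ?case using elim by (simp add: add_divide_distrib)
  qed
  then have "limsup (\<lambda>n. ereal (real (a n) / real n)) \<le> limsup (\<lambda>n. ereal (C / real n + L))"
    by (rule Limsup_mono)
  also have "(\<lambda>n. C / real n + L) \<longlonglongrightarrow> 0 + L"
    by (intro tendsto_add lim_const_over_n tendsto_const)
  then have "limsup (\<lambda>n. ereal (C / real n + L)) = ereal L"
    by (intro lim_imp_Limsup) auto
  finally show ?thesis .
qed

theorem theorem3p5:
  fixes F :: "'a ugraph" and U W :: "'a set" and r k :: nat
  assumes "is_graph F"
    and "U \<subseteq> verts F" and "W \<subseteq> verts F" and "U \<inter> W = {}"
    and "card (U \<union> W) = r"
    and "card {e \<in> edges F. \<exists>u\<in>U. \<exists>w\<in>W. e = {u, w}} = 1"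
    and "card ((nbhd F U \<union> nbhd F W) - (U \<union> W)) = k"
  shows "limsup (\<lambda>n. ereal (real (csat n F) / real n)) \<le> ereal (real k + (real r - 1) / 2)"
proof (rule limsup_ratio_le)
  fix n assume n: "card (verts F) \<le> n"
  obtain e where e: "{e \<in> edges F. \<exists>u\<in>U. \<exists>w\<in>W. e = {u, w}} = {e}"
    using assms(6) by (auto simp: card_1_singleton_iff)
  then have "e \<in> {e \<in> edges F. \<exists>u\<in>U. \<exists>w\<in>W. e = {u, w}}" by simp
  then obtain u w where uw: "u \<in> U" "w \<in> W" "{u, w} \<in> edges F" "e = {u, w}" by auto
  have finF: "finite (verts F)" using assms(1) by (simp add: is_graph_def)
  have finUW: "finite (U \<union> W)" using finite_subset[of _ "verts F"] assms(2,3) finF by blast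
  have r: "0 < r" using assms(5) uw(1) finUW by (auto simp: card_gt_0_iff)
  have kF: "k \<le> card (verts F)"
    unfolding assms(7)[symmetric] using finF by (intro card_mono) (auto simp: nbhd_def)
  \<comment> \<open>The core absorbs the remainder modulo \<open>r\<close>, so that the outer vertices split into
    blocks of exactly \<open>r\<close> vertices.\<close>
  define c where "c = card (verts F) + (n - card (verts F)) mod r"
  define m where "m = (n - card (verts F)) div r"
  have nc: "n = c + m * r" using n by (simp add: c_def m_def)
  have c: "card (verts F) \<le> c" "c \<le> card (verts F) + r" using r by (auto simp: c_def)
  interpret hub_construction F U W "(nbhd F U \<union> nbhd F W) - (U \<union> W)" u w
    "{..<n}" "{..<k}" "interval_block c r" 0
  proof
    show "{s, t} = {u, w}" if "s \<in> U" "t \<in> W" "{s, t} \<in> edges F" for s t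
    proof -
      have "{s, t} \<in> {e \<in> edges F. \<exists>u\<in>U. \<exists>w\<in>W. e = {u, w}}" using that by blast
      then show ?thesis unfolding e using uw(4) by simp
    qed
    show "card (verts F) \<le> card {v \<in> {..<n}. interval_block c r v = 0}"
      using interval_block_core[of c n r] nc c by simp
    show "card (U \<union> W) \<le> card {v \<in> {..<n}. interval_block c r v = interval_block c r x}"
      if x: "x \<in> {..<n}" "interval_block c r x \<noteq> 0" for x
    proof -
      obtain i where i: "interval_block c r x = Suc i" using x(2) not0_implies_Suc by blast
      then have "i < m"
        using x nc r by (auto simp: interval_block_def less_mult_imp_div_less split: if_splits)
      then show ?thesis using interval_block_outer[OF r, of i m c] i nc assms(5) by simp
    qed
  qed (use assms uw kF c nc in \<open>auto simp: interval_block_def\<close>)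
  have "real (csat n F) \<le> real (card (edges G))"
    using csat_le[OF is_graph_G _ cov_sat_G] by simp
  also have "\<dots> \<le> 2 ^ c + real (m * r) * (real k + (real r - 1) / 2)"
    unfolding nc using kF c by (intro card_edges_hub_graph_le[OF r]) simp
  also have "\<dots> \<le> 2 ^ (card (verts F) + r) + real n * (real k + (real r - 1) / 2)"
    using r c nc by (intro add_mono mult_right_mono power_increasing) auto
  finally show "real (csat n F) \<le> 2 ^ (card (verts F) + r) + real n * (real k + (real r - 1) / 2)" .
qed

end
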